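(* Let $S_1\in\mathbb{R}^{p_1\times n}$ and $S_2\in\mathbb{R}^{p_2\times p_1}$ be independently generated $(\varepsilon_1,d_1,m)$ and $(\varepsilon_2,d_2,m)$ oblivious $\ell_2$-subspace embeddings, respectively. Put $d=d_1+d_2-d_1d_2$, $\varepsilon_L=\varepsilon_1+\varepsilon_2-\varepsilon_1\varepsilon_2$, $\varepsilon_H=\varepsilon_1+\varepsilon_2+\varepsilon_1\varepsilon_2$, and suppose $\varepsilon_L\in\left[0,\frac{616}{625}-\frac{9}{625}\varepsilon_H\right)$. Suppose $V\in\mathbb{R}^{n\times m}$ has full rank, $1<m\le p_2\le p_1\le n$, $nm\mathbf{u}\le\frac1{12}$, $p_1\sqrt{p_2}\,\mathbf{u}\le\frac1{12}$, and $$\delta:=\frac{383\left(\sqrt{1+\varepsilon_H}\,p_2m^{3/2}+\sqrt m\,\|S_2\|_2\left(p_1\sqrt{p_2}\sqrt{1+\varepsilon_1}+n\|S_1\|_F\right)\right)}{\sqrt{1-\varepsilon_L}}\,\mathbf{u}\,\kappa(V)\le 1 .$$ Let $\hat Q$ be the matrix computed in floating point arithmetic by $\texttt{randQR}(V,S_1,S_2)$. Then, with probability at least $1-d$, $\kappa(\hat Q)=O(1)$; in fact $$\kappa(\hat Q)\le\frac{33}{25\sqrt{\frac{1-\varepsilon_L}{1+\varepsilon_H}}-3}.$$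
   Context: Embeddings. For $\varepsilon\in[0,1)$, a matrix $S\in\mathbb{R}^{p\times n}$ is an $\varepsilon$-subspace embedding for a subspace $\mathcal V\subset\mathbb{R}^n$ if $|\langle x,y\rangle-\langle Sx,Sy\rangle|\le\varepsilon\|x\|_2\|y\|_2$ for all $x,y\in\mathcal V$. A random $S\in\mathbb{R}^{p\times n}$ is an $(\varepsilon,d,m)$ oblivious $\ell_2$-subspace embedding if, for any fixed $m$-dimensional subspace $\mathcal V\subset\mathbb{R}^n$, it is an $\varepsilon$-subspace embedding for $\mathcal V$ with probability at least $1-d$. Probabilities are over the draw of the sketch matrices; $V$ is fixed. The norms of $S_1,S_2$ appearing in $\delta$ are those of the drawn matrices, for which $\delta\le1$ is assumed. Notation. $\sigma_1\ge\dots\ge\sigma_m$ are singular values, $\kappa(X)=\sigma_1(X)/\sigma_m(X)$ for $X$ with $m$ columns, $\mathbf{u}$ is the unit roundoff, $\gamma_k=\frac{k\mathbf{u}}{1-k\mathbf{u}}$, $|A|$ is the entrywise absolute value (inequalities between such matrices are entrywise), hats denote computed quantities. Algorithm $\texttt{randQR}(V,S_1,S_2)$: (1) compute $W_1=S_1V$ and then $W=S_2W_1$; (2) compute a Householder QR factorization of $W$, keeping its $m\times m$ upper triangular factor $R$; (3) compute $Q=VR^{-1}$ by solving the triangular system $QR=V$ row by row. Output $Q,R$. Floating point. All steps are executed in the standard model of floating point arithmetic with unit roundoff $\mathbf{u}$ (each elementary operation has relative error at most $\mathbf{u}$, no overflow or underflow). The standard rounding error bounds for the subroutines are: a computed product of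 matrices $A,B$ with inner dimension $k$ is $AB+\Delta C$ with $|\Delta C|\le\gamma_k|A||B|$; Householder QR of $\hat W\in\mathbb{R}^{p_2\times m}$ returns upper triangular $\hat R$ for which there is a $Q_{tmp}\in\mathbb{R}^{p_2\times m}$ with exactly orthonormal columns and $\hat W+E_2=Q_{tmp}\hat R$, where $\|(E_2)_j\|_2\le\gamma_{29p_2m}\|\hat w_j\|_2$ for each column $j$; the row-wise solution of $Q\hat R=V$ returns $\hat Q$ with $\hat Q_{i,:}(\hat R+\Delta R_i)=V_{i,:}$, $|\Delta R_i|\le\gamma_m|\hat R|$, for each row $i$. *)

theory Defs
  imports "HOL-Probability.Probability"
begin

text \<open>A \<open>p \<times> n\<close> matrix is a term of type \<open>real^'n^'p\<close>. On matrices, the library's \<open>norm\<close> is the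
  Frobenius norm, and the library's \<open>\<le>\<close> and \<open>\<bar>_\<bar>\<close> are entrywise.\<close>

abbreviation frobenius_norm :: "real^'n^'p \<Rightarrow> real" where
  "frobenius_norm A \<equiv> norm A"

lemma frobenius_norm_eq: "frobenius_norm A = sqrt (\<Sum>i\<in>UNIV. \<Sum>j\<in>UNIV. (A $ i $ j)\<^sup>2)"
  by (simp add: norm_vec_def L2_set_def sum_nonneg)

abbreviation spectral_norm :: "real^'n^'p \<Rightarrow> real" where
  "spectral_norm A \<equiv> onorm ((*v) A)"

section \<open>Singular values\<close>

text \<open>The singular values of a matrix with \<open>m\<close> columns (and at least \<open>m\<close> rows) are the nonnegative
  square roots of the eigenvalues of its Gram matrix.  Only \<open>\<sigma>\<^sub>1\<close> and \<open>\<sigma>\<^sub>m\<close> are needed, so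
  multiplicities are not recorded.\<close>

definition singular_values :: "real^'m^'n \<Rightarrow> real set" where
  "singular_values X =
     {s. 0 \<le> s \<and> (\<exists>v. v \<noteq> 0 \<and> (transpose X ** X) *v v = s\<^sup>2 *\<^sub>R v)}"

definition sigma_max :: "real^'m^'n \<Rightarrow> real" where
  "sigma_max X = Max (singular_values X)"

definition sigma_min :: "real^'m^'n \<Rightarrow> real" where
  "sigma_min X = Min (singular_values X)"

text \<open>Extended-real valued, so that a rank deficient matrix has condition number \<open>\<infinity>\<close> rather than
  the value \<open>0\<close> that division by zero would give.\<close>

definition cond_number :: "real^'m^'n \<Rightarrow> ereal" where
  "cond_number X = (if sigma_min X = 0 then \<infinity> else ereal (sigma_max X / sigma_min X))"

section \<open>Subspace embeddings\<close>

definition subspace_embedding :: "real \<Rightarrow> real^'n^'p \<Rightarrow> (real^'n) set \<Rightarrow> bool" where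
  "subspace_embedding \<epsilon> S U \<longleftrightarrow>
     (\<forall>x\<in>U. \<forall>y\<in>U. \<bar>x \<bullet> y - (S *v x) \<bullet> (S *v y)\<bar> \<le> \<epsilon> * norm x * norm y)"

text \<open>The random matrix \<open>S\<close> is a random variable on the probability space \<open>M\<close>.\<close>

definition oblivious_embedding ::
    "'w measure \<Rightarrow> real \<Rightarrow> real \<Rightarrow> nat \<Rightarrow> ('w \<Rightarrow> real^'n^'p) \<Rightarrow> bool" where
  "oblivious_embedding M \<epsilon> d m S \<longleftrightarrow>
     S \<in> borel_measurable M \<and>
     (\<forall>U. subspace U \<and> dim U = m \<longrightarrow>
        measure M {\<omega> \<in> space M. subspace_embedding \<epsilon> (S \<omega>) U} \<ge> 1 - d)"

text \<open>The library's \<open>indep_var\<close> forces both variables into the same type, which matrices of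
  different shapes do not have; this is independence of the generated \<open>\<sigma>\<close>-algebras.\<close>

definition independent_matrices ::
    "'w measure \<Rightarrow> ('w \<Rightarrow> real^'a^'b) \<Rightarrow> ('w \<Rightarrow> real^'c^'d) \<Rightarrow> bool" where
  "independent_matrices M X Y \<longleftrightarrow>
     prob_space.indep_set M
       {X -` A \<inter> space M | A. A \<in> sets borel} {Y -` B \<inter> space M | B. B \<in> sets borel}"

section \<open>The algorithm randQR in floating point arithmetic\<close>

text \<open>Floating point arithmetic enters through the standard rounding error bounds of the
  subroutines: each predicate describes the results its subroutine may return when the unit roundoff
  is \<open>u\<close>.\<close>

definition gam :: "real \<Rightarrow> nat \<Rightarrow> real" where
  "gam u k = real k * u / (1 - real k * u)"

definition fl_matmul :: "real \<Rightarrow> real^'k^'p \<Rightarrow> real^'n^'k \<Rightarrow> real^'n^'p \<Rightarrow> bool" where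
  "fl_matmul u A B C \<longleftrightarrow>
     (\<exists>\<Delta>C. C = A ** B + \<Delta>C \<and> \<bar>\<Delta>C\<bar> \<le> gam u CARD('k) *\<^sub>R (\<bar>A\<bar> ** \<bar>B\<bar>))"

text \<open>The order of the column index type \<open>'m\<close> serves to express triangularity.\<close>

definition upper_triangular :: "real^('m::{finite,linorder})^('m::{finite,linorder}) \<Rightarrow> bool" where
  "upper_triangular R \<longleftrightarrow> (\<forall>i j. j < i \<longrightarrow> R $ i $ j = 0)"

definition fl_householder_R ::
    "real \<Rightarrow> real^('m::{finite,linorder})^'p \<Rightarrow>
     real^('m::{finite,linorder})^('m::{finite,linorder}) \<Rightarrow> bool" where
  "fl_householder_R u W R \<longleftrightarrow>
     upper_triangular R \<and>
     (\<exists>(Qtmp :: real^('m::{finite,linorder})^'p) (E :: real^('m::{finite,linorder})^'p).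
        transpose Qtmp ** Qtmp = mat 1 \<and> W + E = Qtmp ** R \<and>
        (\<forall>j. norm (column j E) \<le> gam u (29 * CARD('p) * CARD('m)) * norm (column j W)))"

text \<open>Solving \<open>Q R = V\<close> row by row is possible only if \<open>R\<close> has no zero on its diagonal.  Otherwise
  the algorithm breaks down and nothing at all is guaranteed about \<open>Q\<close>; so a bound on \<open>Q\<close> can hold
  only where breakdown is excluded.\<close>

definition fl_row_solve ::
    "real \<Rightarrow> real^('m::{finite,linorder})^('m::{finite,linorder}) \<Rightarrow> real^('m::{finite,linorder})^'n \<Rightarrow>
     real^('m::{finite,linorder})^'n \<Rightarrow> bool" where
  "fl_row_solve u R V Q \<longleftrightarrow>
     ((\<forall>j. R $ j $ j \<noteq> 0) \<longrightarrow>
      (\<forall>i. \<exists>\<Delta>R. (Q $ i) v* (R + \<Delta>R) = V $ i \<and> \<bar>\<Delta>R\<bar> \<le> gam u CARD('m) *\<^sub>R \<bar>R\<bar>))"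

definition fl_randQR ::
    "real \<Rightarrow> real^('m::{finite,linorder})^'n \<Rightarrow> real^'n^'p1 \<Rightarrow> real^'p1^'p2 \<Rightarrow>
     real^('m::{finite,linorder})^'n \<Rightarrow>
     real^('m::{finite,linorder})^('m::{finite,linorder}) \<Rightarrow> bool" where
  "fl_randQR u V S\<^sub>1 S\<^sub>2 Q R \<longleftrightarrow>
     (\<exists>W\<^sub>1 W. fl_matmul u S\<^sub>1 V W\<^sub>1 \<and> fl_matmul u S\<^sub>2 W\<^sub>1 W \<and>
        fl_householder_R u W R \<and> fl_row_solve u R V Q)"

end

theory Submission
  imports Defs
begin

text \<open>The embedding \<open>S\<^sub>2\<close> has to embed the random subspace \<open>S\<^sub>1 (range V)\<close>; since it is independent of
  \<open>S\<^sub>1\<close>, Fubini's theorem for the joint law gives both embeddings with probability at least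
  \<open>(1 - d\<^sub>1) (1 - d\<^sub>2) = 1 - d\<close>. On that event, with \<open>a = sqrt (1 - \<epsilon>\<^sub>L)\<close> and \<open>b = sqrt (1 + \<epsilon>\<^sub>H)\<close>,
  \<open>a |V x| \<le> |S\<^sub>2 S\<^sub>1 V x| \<le> b |V x|\<close>. The hypothesis \<open>\<delta> \<le> 1\<close> makes the errors of sketching and of
  the Householder factorization at most \<open>a \<sigma>\<^sub>m(V) / 10\<close> altogether, so \<open>|R x|\<close> lies between
  \<open>(9/10) a |V x|\<close> and \<open>(b + a/10) |V x|\<close>. The residual \<open>Q R - V\<close> of the triangular solve is bounded
  in terms of the norm of \<open>Q\<close> itself; solving this self-referential inequality bounds \<open>|Q|\<close>, and then
  \<open>Q R x \<approx> V x\<close> yields two-sided bounds on the gain of \<open>Q\<close>.\<close>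

section \<open>Extremal singular values\<close>

text \<open>If \<open>w = f v\<close> were nonzero, moving from \<open>v\<close> to
  \<open>v - t w\<close> would change the quadratic form by
  \<open>t^2 (w, f w) - 2 t (w, w)\<close>, which is negative for small positive \<open>t\<close>.
  This replaces Lagrange multipliers in showing that vectors of extremal gain are
  eigenvectors.\<close>

lemma psd_isotropic_in_kernel:
  fixes f :: "'a::real_inner \<Rightarrow> 'a"
  assumes "linear f" and sym: "\<And>x y. f x \<bullet> y = x \<bullet> f y"
    and psd: "\<And>x. 0 \<le> x \<bullet> f x" and "v \<bullet> f v = 0"
  shows "f v = 0"
proof (rule ccontr)
  assume "f v \<noteq> 0"
  define w where "w = f v"
  \<comment> \<open>The summand 1 keeps the denominator positive even if
    \<open>w \<bullet> f w = 0\<close>; this step length gives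
    \<open>t * (w \<bullet> f w) = w \<bullet> w - t\<close>, so the form drops strictly below
    0.\<close>
  define t where "t = (w \<bullet> w) / (1 + w \<bullet> f w)"
  have w: "0 < w \<bullet> w" using \<open>f v \<noteq> 0\<close> by (simp add: w_def)
  have p: "0 < 1 + w \<bullet> f w" using psd[of w] by simp
  have t: "0 < t" using w p by (simp add: t_def)
  have "(v - t *\<^sub>R w) \<bullet> f (v - t *\<^sub>R w) = t * (t * (w \<bullet> f w) - 2 * (w \<bullet> w))"
    using assms(4) sym[of v w]
    by (simp add: linear_diff[OF assms(1)] linear_scale[OF assms(1)] inner_diff inner_commute
        w_def[symmetric] algebra_simps)
  then have "0 \<le> t * (t * (w \<bullet> f w) - 2 * (w \<bullet> w))" using psd[of "v - t *\<^sub>R w"] by simp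
  then have "2 * (w \<bullet> w) \<le> t * (w \<bullet> f w)" using t by (simp add: zero_le_mult_iff)
  moreover have "t * (w \<bullet> f w) = w \<bullet> w - t" using p by (simp add: t_def field_simps)
  ultimately show False using t w by simp
qed

lemma inner_gram:
  fixes X :: "real^'m^'n"
  shows "x \<bullet> ((transpose X ** X) *v y) = (X *v x) \<bullet> (X *v y)"
  by (metis dot_lmul_matrix matrix_vector_mul_assoc transpose_matrix_vector inner_commute)

lemma singular_value_gain:
  assumes "s \<in> singular_values X"
  obtains v where "v \<noteq> 0" "norm (X *v v) = s * norm v"
proof -
  obtain v where v: "0 \<le> s" "v \<noteq> 0" "(transpose X ** X) *v v = s\<^sup>2 *\<^sub>R v"
    using assms by (auto simp: singular_values_def)
  have "(norm (X *v v))\<^sup>2 = (s * norm v)\<^sup>2"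
    using inner_gram[of v X v] v(3) by (simp add: power2_norm_eq_inner power_mult_distrib)
  then show thesis using that v by (simp add: power2_eq_iff_nonneg)
qed

text \<open>Eigenvectors of the symmetric Gram matrix for different singular values are orthogonal,
  and a pairwise orthogonal set in finite dimension is finite. Finiteness is what makes the
  \<open>Min\<close> and \<open>Max\<close> in \<open>sigma_min\<close> and \<open>sigma_max\<close>
  meaningful.\<close>

lemma finite_singular_values: "finite (singular_values X)"
proof -
  let ?G = "transpose X ** X"
  have "\<exists>v. \<forall>s\<in>singular_values X. v s \<noteq> 0 \<and> ?G *v v s = s\<^sup>2 *\<^sub>R v s"
    by (rule bchoice) (auto simp: singular_values_def)
  then obtain v where v: "\<And>s. s \<in> singular_values X \<Longrightarrow> v s \<noteq> 0"
      "\<And>s. s \<in> singular_values X \<Longrightarrow> ?G *v v s = s\<^sup>2 *\<^sub>R v s" by blast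
  have orth: "v s \<bullet> v t = 0"
    if s: "s \<in> singular_values X" and t: "t \<in> singular_values X" and "s \<noteq> t" for s t
  proof -
    have "t\<^sup>2 * (v s \<bullet> v t) = s\<^sup>2 * (v s \<bullet> v t)"
      using inner_gram[of "v s" X "v t"] inner_gram[of "v t" X "v s"] v(2)[OF s] v(2)[OF t]
      by (simp add: inner_commute)
    moreover have "s\<^sup>2 \<noteq> t\<^sup>2"
      using s t \<open>s \<noteq> t\<close> by (simp add: singular_values_def power2_eq_iff_nonneg)
    ultimately show ?thesis by simp
  qed
  have "inj_on v (singular_values X)"
    by (rule inj_onI) (metis orth v(1) inner_eq_zero_iff)
  moreover have "pairwise orthogonal (v ` singular_values X)"
    by (auto simp: pairwise_def orthogonal_def intro!: orth)
  ultimately show ?thesis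
    using pairwise_orthogonal_imp_finite finite_imageD by blast
qed

text \<open>If \<open>s\<close> bounds the gain of \<open>X\<close> from below
  (\<open>c = 1\<close>) or from above (\<open>c = -1\<close>), then \<open>c\<close> times the Gram
  matrix minus \<open>s\<^sup>2\<close> times the identity is positive semidefinite. Its form
  vanishes at \<open>v\<close>, so \<open>v\<close> lies in its kernel.\<close>

lemma extremal_gain_singular_value:
  fixes X :: "real^'m^'n"
  assumes "0 \<le> s" "v \<noteq> 0" "norm (X *v v) = s * norm v"
    and "(\<forall>x. s * norm x \<le> norm (X *v x)) \<or> (\<forall>x. norm (X *v x) \<le> s * norm x)"
  shows "s \<in> singular_values X"
proof -
  define c :: real where "c = (if \<forall>x. s * norm x \<le> norm (X *v x) then 1 else -1)"
  define f where "f x = c *\<^sub>R ((transpose X ** X) *v x - s\<^sup>2 *\<^sub>R x)" for x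
  have inner_f: "x \<bullet> f y = c * ((X *v x) \<bullet> (X *v y) - s\<^sup>2 * (x \<bullet> y))" for x y
    by (simp add: f_def inner_diff_right inner_gram)
  have form: "x \<bullet> f x = c * ((norm (X *v x))\<^sup>2 - (s * norm x)\<^sup>2)" for x
    by (simp add: inner_f power2_norm_eq_inner power_mult_distrib)
  have "f v = 0"
  proof (rule psd_isotropic_in_kernel[where f = f])
    show "linear f"
      by (rule linearI)
        (simp_all only: f_def matrix_vector_right_distrib matrix_vector_mult_scaleR, simp_all add: algebra_simps)
    show "f x \<bullet> y = x \<bullet> f y" for x y
      using inner_f[of x y] inner_f[of y x] by (simp add: inner_commute)
    show "0 \<le> x \<bullet> f x" for x
      using assms(1,4) unfolding form
      by (auto simp: c_def intro!: power_mono)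
    show "v \<bullet> f v = 0" using assms(3) by (simp add: form)
  qed
  then show ?thesis using assms(1,2) by (auto simp: singular_values_def f_def c_def split: if_splits)
qed

lemma norm_mult_unit_bounds:
  fixes X :: "real^'m^'n"
  shows "(\<forall>y\<in>sphere 0 1. s \<le> norm (X *v y)) \<Longrightarrow> s * norm x \<le> norm (X *v x)"
    and "(\<forall>y\<in>sphere 0 1. norm (X *v y) \<le> s) \<Longrightarrow> norm (X *v x) \<le> s * norm x"
proof -
  have unit: "norm (X *v x) = norm (X *v ((1 / norm x) *\<^sub>R x)) * norm x" if "x \<noteq> 0"
    using that by (simp add: matrix_vector_mult_scaleR)
  have sph: "(1 / norm x) *\<^sub>R x \<in> sphere 0 1" if "x \<noteq> 0" using that by simp
  show "s * norm x \<le> norm (X *v x)" if "\<forall>y\<in>sphere 0 1. s \<le> norm (X *v y)"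
    using that sph unit by (cases "x = 0") (auto simp del: mem_sphere intro!: mult_right_mono)
  show "norm (X *v x) \<le> s * norm x" if "\<forall>y\<in>sphere 0 1. norm (X *v y) \<le> s"
    using that sph unit by (cases "x = 0") (auto simp del: mem_sphere intro!: mult_right_mono)
qed

lemma continuous_on_norm_mult: "continuous_on A (\<lambda>x. norm (X *v x))" for X :: "real^'m^'n"
  by (intro continuous_on_norm linear_continuous_on) simp

text \<open>The gain attains its minimum on the compact unit sphere, and by homogeneity this minimum
  bounds the gain at every vector, as \<open>extremal_gain_singular_value\<close> requires.\<close>

lemma least_gain_singular_value:
  fixes X :: "real^'m^'n"
  obtains s where "s \<in> singular_values X" "\<And>x. s * norm x \<le> norm (X *v x)"
proof -
  obtain v where v: "v \<in> sphere 0 1" "\<forall>y\<in>sphere 0 1. norm (X *v v) \<le> norm (X *v y)"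
    using continuous_attains_inf[OF compact_sphere _ continuous_on_norm_mult[of _ X]]
    by (metis sphere_eq_empty not_one_less_zero)
  have *: "norm (X *v v) * norm x \<le> norm (X *v x)" for x
    using norm_mult_unit_bounds(1) v(2) by blast
  moreover have "norm (X *v v) \<in> singular_values X"
    using v(1) * by (intro extremal_gain_singular_value[of _ v]) auto
  ultimately show thesis using that by blast
qed

lemma greatest_gain_singular_value:
  fixes X :: "real^'m^'n"
  obtains s where "s \<in> singular_values X" "\<And>x. norm (X *v x) \<le> s * norm x"
proof -
  obtain v where v: "v \<in> sphere 0 1" "\<forall>y\<in>sphere 0 1. norm (X *v y) \<le> norm (X *v v)"
    using continuous_attains_sup[OF compact_sphere _ continuous_on_norm_mult[of _ X]]
    by (metis sphere_eq_empty not_one_less_zero)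
  have *: "norm (X *v x) \<le> norm (X *v v) * norm x" for x
    using norm_mult_unit_bounds(2) v(2) by blast
  moreover have "norm (X *v v) \<in> singular_values X"
    using v(1) * by (intro extremal_gain_singular_value[of _ v]) auto
  ultimately show thesis using that by blast
qed

lemma sigma_min_in: "sigma_min X \<in> singular_values X"
  and sigma_max_in: "sigma_max X \<in> singular_values X"
  using least_gain_singular_value[of X] finite_singular_values[of X]
  by (metis Min_in Max_in sigma_min_def sigma_max_def empty_iff)+

lemma sigma_min_gain: "sigma_min X * norm x \<le> norm (X *v x)"
proof -
  obtain s where s: "s \<in> singular_values X" "s * norm x \<le> norm (X *v x)"
    using least_gain_singular_value[of X] by metis
  have "sigma_min X \<le> s" using s(1) by (simp add: sigma_min_def finite_singular_values)
  then show ?thesis using s(2) by (meson mult_right_mono norm_ge_zero order_trans)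
qed

lemma sigma_max_gain: "norm (X *v x) \<le> sigma_max X * norm x"
proof -
  obtain s where s: "s \<in> singular_values X" "norm (X *v x) \<le> s * norm x"
    using greatest_gain_singular_value[of X] by metis
  have "s \<le> sigma_max X" using s(1) by (simp add: sigma_max_def finite_singular_values)
  then show ?thesis using s(2) by (meson mult_right_mono norm_ge_zero order_trans)
qed

text \<open>Every singular value is the gain of some nonzero vector and so lies between
  \<open>l\<close> and \<open>h\<close>; \<open>0 < l\<close> excludes the infinite case.\<close>

lemma cond_number_le:
  fixes X :: "real^'m^'n"
  assumes "0 < l" "\<And>x. l * norm x \<le> norm (X *v x)" "\<And>x. norm (X *v x) \<le> h * norm x"
  shows "cond_number X \<le> ereal (h / l)"
proof -
  have "l \<le> s \<and> s \<le> h" if "s \<in> singular_values X" for s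
    using singular_value_gain[OF that] assms(2,3) by (metis mult_le_cancel_right_pos zero_less_norm_iff)
  then have "l \<le> sigma_min X" "sigma_max X \<le> h" "0 \<le> sigma_max X"
    using sigma_min_in[of X] sigma_max_in[of X] assms(1) by (auto simp: singular_values_def)
  then show ?thesis
    using assms(1) by (auto simp: cond_number_def intro!: frac_le)
qed

lemma full_rank_sigma_min_pos:
  fixes X :: "real^'m^'n"
  assumes "rank X = CARD('m)"
  shows "0 < sigma_min X"
proof -
  obtain v where v: "v \<noteq> 0" "norm (X *v v) = sigma_min X * norm v"
    using singular_value_gain[OF sigma_min_in] by metis
  have "X *v v \<noteq> X *v 0" using assms v(1) full_rank_injective[of X] by (meson injD)
  then have "sigma_min X \<noteq> 0" using v(2) by auto
  then show ?thesis using sigma_min_in[of X] by (simp add: singular_values_def)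
qed

section \<open>Frobenius norm bounds for the subroutines\<close>

lemma norm_matrix_columns:
  fixes A :: "real^'n^'p"
  shows "(norm A)\<^sup>2 = (\<Sum>j\<in>UNIV. (norm (column j A))\<^sup>2)"
  by (simp add: norm_vec_def L2_set_def sum_nonneg column_def) (rule sum.swap)

lemma norm_matrix_le_columns:
  fixes A :: "real^'n^'p" and B :: "real^'n^'q"
  assumes "0 \<le> c" "\<And>j. norm (column j A) \<le> c * norm (column j B)"
  shows "norm A \<le> c * norm B"
proof (rule power2_le_imp_le)
  have "(norm A)\<^sup>2 \<le> (\<Sum>j\<in>UNIV. (c * norm (column j B))\<^sup>2)"
    unfolding norm_matrix_columns by (intro sum_mono power_mono assms) auto
  then show "(norm A)\<^sup>2 \<le> (c * norm B)\<^sup>2"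
    by (simp add: power_mult_distrib norm_matrix_columns sum_distrib_left)
qed (use assms in simp)

text \<open>Each column is the image of a unit vector, hence has norm at most \<open>c\<close>. The
  factors \<open>sqrt m\<close> of the error analysis come from here.\<close>

lemma norm_matrix_le_gain:
  fixes A :: "real^'n^'p"
  assumes "\<And>x. norm (A *v x) \<le> c * norm x"
  shows "norm A \<le> sqrt (real CARD('n)) * c"
proof (rule power2_le_imp_le)
  have col: "norm (column j A) \<le> c" for j
    using assms[of "axis j 1"] by (simp add: matrix_vector_mult_basis)
  have "(norm A)\<^sup>2 \<le> (\<Sum>j\<in>(UNIV::'n set). c\<^sup>2)"
    unfolding norm_matrix_columns by (intro sum_mono power_mono col) auto
  then show "(norm A)\<^sup>2 \<le> (sqrt (real CARD('n)) * c)\<^sup>2"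
    by (simp add: power_mult_distrib)
  show "0 \<le> sqrt (real CARD('n)) * c"
    using order_trans[OF norm_ge_zero col] by simp
qed

lemma column_matrix_mult: "column j (A ** B) = A *v column j B" for A :: "real^'k^'p"
  by (metis matrix_vector_mul_assoc matrix_vector_mult_basis)

lemma norm_matrix_mult_le_gain:
  fixes A :: "real^'k^'p"
  assumes "0 \<le> c" "\<And>x. norm (A *v x) \<le> c * norm x"
  shows "norm (A ** B) \<le> c * norm B"
  by (intro norm_matrix_le_columns) (simp_all add: assms column_matrix_mult)

lemma norm_matrix_vector_mult_le: "norm (A *v x) \<le> norm A * norm x" for A :: "real^'n^'p"
proof -
  have "norm (A *v x) \<le> norm (norm x *\<^sub>R A)"
  proof (rule norm_le_componentwise_cart)
    show "norm ((A *v x) $ i) \<le> norm ((norm x *\<^sub>R A) $ i)" for i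
      using Cauchy_Schwarz_ineq2[of "A $ i" x] by (simp add: matrix_mult_dot mult.commute)
  qed
  then show ?thesis by (simp add: mult.commute)
qed

lemma norm_matrix_mult_le: "norm (A ** B) \<le> norm A * norm B" for A :: "real^'k^'p"
  by (intro norm_matrix_mult_le_gain norm_matrix_vector_mult_le) simp

lemma norm_transpose [simp]: "norm (transpose A) = norm A" for A :: "real^'n^'p"
  using norm_matrix_columns[of "transpose A"]
  by (simp add: norm_vec_def[of A] L2_set_def real_sqrt_unique transpose_def column_def sum_nonneg)

lemma norm_vector_matrix_mult_le: "norm (x v* A) \<le> norm x * norm A" for A :: "real^'n^'p"
  using norm_matrix_vector_mult_le[of "transpose A" x] by (simp add: mult.commute)

text \<open>The argument passes to the transpose so that the factor counts rows: for the second
  sketch this gives \<open>sqrt p\<^sub>2\<close> instead of \<open>sqrt p\<^sub>1\<close>.\<close>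

lemma norm_matrix_le_spectral:
  fixes A :: "real^'n^'p"
  shows "norm A \<le> sqrt (real CARD('p)) * spectral_norm A"
proof -
  have "norm (x v* A) \<le> spectral_norm A * norm x" for x
  proof (cases "x v* A = 0")
    case True
    then show ?thesis by (simp add: onorm_pos_le)
  next
    case False
    \<comment> \<open>Pairing \<open>x v* A\<close> with itself moves one factor through the
      adjoint, so the transpose has gain at most the spectral norm of \<open>A\<close>.\<close>
    have "norm (x v* A) * norm (x v* A) = x \<bullet> (A *v (x v* A))"
      by (simp add: dot_square_norm power2_eq_square flip: dot_lmul_matrix)
    also have "\<dots> \<le> norm x * norm (A *v (x v* A))" by (rule norm_cauchy_schwarz)
    also have "\<dots> \<le> norm x * (spectral_norm A * norm (x v* A))"
      by (intro mult_left_mono onorm) auto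
    finally show ?thesis using False by (simp add: mult.commute mult.left_commute)
  qed
  then show ?thesis using norm_matrix_le_gain[of "transpose A" "spectral_norm A"] by simp
qed

lemma norm_matrix_abs: "norm \<bar>A\<bar> = norm A" for A :: "real^'n^'p"
  by (simp add: norm_vec_def abs_vec_def)

lemma norm_matrix_le_entrywise:
  fixes A B :: "real^'n^'p"
  assumes "\<bar>A\<bar> \<le> c *\<^sub>R B"
  shows "norm A \<le> \<bar>c\<bar> * norm B"
proof -
  have "\<bar>A $ i $ j\<bar> \<le> \<bar>c * B $ i $ j\<bar>" for i j
    using assms by (auto simp: less_eq_vec_def abs_vec_def intro: order_trans[OF _ abs_ge_self])
  then have "norm A \<le> norm (c *\<^sub>R B)"
    by (intro norm_le_componentwise_cart) simp
  then show ?thesis by simp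
qed

text \<open>The Frobenius norm is monotone in the absolute values of the entries and unchanged by
  taking them, so the entrywise bound passes to norms without loss of a dimension factor.\<close>

lemma fl_matmul_error:
  fixes A :: "real^'k^'p" and B :: "real^'n^'k"
  assumes "fl_matmul u A B C" "0 \<le> gam u CARD('k)"
  shows "norm (C - A ** B) \<le> gam u CARD('k) * (norm A * norm B)"
proof -
  obtain D where D: "C = A ** B + D" "\<bar>D\<bar> \<le> gam u CARD('k) *\<^sub>R (\<bar>A\<bar> ** \<bar>B\<bar>)"
    using assms(1) by (auto simp: fl_matmul_def)
  have "norm D \<le> gam u CARD('k) * norm (\<bar>A\<bar> ** \<bar>B\<bar>)"
    using norm_matrix_le_entrywise[OF D(2)] assms(2) by simp
  also have "\<dots> \<le> gam u CARD('k) * (norm A * norm B)"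
    using norm_matrix_mult_le[of "\<bar>A\<bar>" "\<bar>B\<bar>"] assms(2)
    by (intro mult_left_mono) (simp_all add: norm_matrix_abs)
  finally show ?thesis using D(1) by simp
qed

text \<open>Orthonormal columns make \<open>Qtmp\<close> an isometry, so \<open>R\<close> has
  exactly the gains of the perturbed matrix; squaring and summing the columnwise bounds gives the
  Frobenius bound.\<close>

lemma fl_householder_R_backward_error:
  fixes W :: "real^('m::{finite,linorder})^'p"
  assumes "fl_householder_R u W R" "0 \<le> gam u (29 * CARD('p) * CARD('m))"
  obtains E where "norm E \<le> gam u (29 * CARD('p) * CARD('m)) * norm W"
    "\<And>x. norm (R *v x) = norm ((W + E) *v x)"
proof -
  obtain Qtmp :: "real^('m::{finite,linorder})^'p" and E :: "real^('m::{finite,linorder})^'p"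
    where Q: "transpose Qtmp ** Qtmp = mat 1" "W + E = Qtmp ** R"
      and E: "\<And>j. norm (column j E) \<le> gam u (29 * CARD('p) * CARD('m)) * norm (column j W)"
    using assms(1) by (auto simp: fl_householder_R_def)
  have "norm (Qtmp *v y) = norm y" for y
    using inner_gram[of y Qtmp y] Q(1) by (simp add: norm_eq_sqrt_inner)
  then have "norm ((W + E) *v x) = norm (R *v x)" for x
    by (simp add: Q(2) flip: matrix_vector_mul_assoc)
  moreover have "norm E \<le> gam u (29 * CARD('p) * CARD('m)) * norm W"
    using assms(2) E by (rule norm_matrix_le_columns)
  ultimately show thesis using that by simp
qed

lemma row_matrix_mult: "(A ** B) $ i = A $ i v* B" for A :: "real^'k^'p"
  by (simp add: vec_eq_iff matrix_matrix_mult_def vector_matrix_mult_def mult.commute)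

text \<open>The perturbation of \<open>R\<close> depends on the row, so the error is moved into a
  residual instead. Row \<open>i\<close> of it is minus \<open>Q $ i v* D\<close>, hence bounded by
  a fixed multiple of row \<open>i\<close> of \<open>Q\<close>, and the rows combine to the
  Frobenius bound.\<close>

lemma fl_row_solve_residual:
  fixes R :: "real^('m::{finite,linorder})^('m::{finite,linorder})"
  assumes "fl_row_solve u R V Q" "\<And>j. R $ j $ j \<noteq> 0" "0 \<le> gam u CARD('m)"
  shows "norm (Q ** R - V) \<le> gam u CARD('m) * (norm Q * norm R)"
proof -
  let ?c = "gam u CARD('m) * norm R"
  have "norm ((Q ** R - V) $ i) \<le> norm ((?c *\<^sub>R Q) $ i)" for i
  proof -
    obtain D where D: "Q $ i v* (R + D) = V $ i" "\<bar>D\<bar> \<le> gam u CARD('m) *\<^sub>R \<bar>R\<bar>"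
      using assms(1,2) by (auto simp: fl_row_solve_def)
    have "(Q ** R - V) $ i = - (Q $ i v* D)"
      by (simp add: row_matrix_mult D(1)[symmetric] vector_matrix_left_distrib
          vec_eq_iff vector_matrix_mult_def sum.distrib algebra_simps)
    moreover have "norm D \<le> ?c"
      using norm_matrix_le_entrywise[OF D(2)] assms(3) by (simp add: norm_matrix_abs)
    then have "norm (Q $ i v* D) \<le> norm (Q $ i) * ?c"
      by (meson norm_vector_matrix_mult_le mult_left_mono norm_ge_zero order_trans)
    ultimately show ?thesis using assms(3) by (simp add: mult.commute abs_mult)
  qed
  then have "norm (Q ** R - V) \<le> norm (?c *\<^sub>R Q)" by (rule norm_le_componentwise_cart)
  then show ?thesis using assms(3) by (simp add: abs_mult mult_ac)
qed

text \<open>A zero in position \<open>j\<close> of the diagonal would make \<open>R\<close> map the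
  vectors supported on indices up to \<open>j\<close> into those supported strictly below
  \<open>j\<close>, a space of smaller dimension. This is what excludes breakdown of the triangular
  solve.\<close>

lemma upper_triangular_inj_diag:
  assumes "upper_triangular R" "inj ((*v) R)"
  shows "R $ j $ j \<noteq> 0"
proof
  assume 0: "R $ j $ j = 0"
  define S where "S = {x. \<forall>i>j. x $ i = (0::real)}"
  define T where "T = {x. \<forall>i\<ge>j. x $ i = (0::real)}"
  have sub: "subspace S" "subspace T" by (auto simp: S_def T_def subspace_def)
  have "(R *v x) $ i = 0" if "x \<in> S" "j \<le> i" for x i
  proof -
    have "R $ i $ k * x $ k = 0" for k
      using that 0 assms(1) unfolding S_def upper_triangular_def
      by (cases k i rule: linorder_cases; cases i j rule: linorder_cases) auto
    then show ?thesis unfolding matrix_vector_mult_def by (simp add: sum.neutral)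
  qed
  then have "(*v) R ` S \<subseteq> T" by (auto simp: T_def)
  then have "dim S \<le> dim T"
    using dim_image_eq[of "(*v) R" S] assms(2) dim_subset[of "(*v) R ` S" T]
    by (metis inj_on_subset matrix_vector_mul_linear subset_UNIV)
  then have "T = S"
    by (intro subspace_dim_equal sub) (auto simp: S_def T_def)
  moreover have "axis j 1 \<in> S" "axis j 1 \<notin> T"
    by (auto simp: S_def T_def axis_def)
  ultimately show False by blast
qed

section \<open>Composing independent embeddings\<close>

lemma continuous_on_matrix_vector_mult:
  fixes f :: "'a::topological_space \<Rightarrow> real^'n^'p"
  assumes "continuous_on T f" "continuous_on T g"
  shows "continuous_on T (\<lambda>t. f t *v g t)"
  unfolding matrix_vector_mult_def by (intro continuous_intros assms)

lemma closed_subspace_embedding: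
  fixes f :: "'a::topological_space \<Rightarrow> real^'n^'k" and g :: "'a \<Rightarrow> real^'k^'p"
  assumes "continuous_on UNIV f" "continuous_on UNIV g"
  shows "closed {t. subspace_embedding \<epsilon> (g t) ((*v) (f t) ` U)}"
proof -
  let ?C = "\<lambda>x y. {t. \<bar>(f t *v x) \<bullet> (f t *v y) - (g t *v (f t *v x)) \<bullet> (g t *v (f t *v y))\<bar>
      \<le> \<epsilon> * norm (f t *v x) * norm (f t *v y)}"
  have "closed (?C x y)" for x y
    by (intro closed_Collect_le continuous_intros continuous_on_matrix_vector_mult assms)
  then have "closed (\<Inter>x\<in>U. \<Inter>y\<in>U. ?C x y)" by blast
  moreover have "{t. subspace_embedding \<epsilon> (g t) ((*v) (f t) ` U)} = (\<Inter>x\<in>U. \<Inter>y\<in>U. ?C x y)"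
    by (auto simp: subspace_embedding_def)
  ultimately show ?thesis by simp
qed

lemma closed_subspace_embedding_fixed: "closed {S :: real^'n^'p. subspace_embedding \<epsilon> S U}"
  using closed_subspace_embedding[of "\<lambda>_ :: real^'n^'p. mat 1 :: real^'n^'n" "\<lambda>S. S" \<epsilon> U] by simp

lemma subspace_embedding_norm:
  assumes "subspace_embedding \<epsilon> S U" "x \<in> U"
  shows "sqrt (1 - \<epsilon>) * norm x \<le> norm (S *v x)" "norm (S *v x) \<le> sqrt (1 + \<epsilon>) * norm x"
proof -
  have "\<bar>(norm x)\<^sup>2 - (norm (S *v x))\<^sup>2\<bar> \<le> \<epsilon> * (norm x)\<^sup>2"
    using assms(1,2) unfolding subspace_embedding_def dot_square_norm[symmetric]
    by (metis dot_square_norm mult.assoc power2_eq_square)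
  then have "(1 - \<epsilon>) * (norm x)\<^sup>2 \<le> (norm (S *v x))\<^sup>2" "(norm (S *v x))\<^sup>2 \<le> (1 + \<epsilon>) * (norm x)\<^sup>2"
    by (simp_all add: abs_le_iff algebra_simps)
  from this[THEN real_sqrt_le_mono]
  show "sqrt (1 - \<epsilon>) * norm x \<le> norm (S *v x)" "norm (S *v x) \<le> sqrt (1 + \<epsilon>) * norm x"
    by (simp_all add: real_sqrt_mult)
qed

text \<open>The lower gain bound is positive, so \<open>S\<close> is injective on \<open>U\<close>.
  The image under the first sketch thus has dimension \<open>m\<close>, as the oblivious property of
  the second demands.\<close>

lemma subspace_embedding_dim:
  assumes "subspace_embedding \<epsilon> S U" "\<epsilon> < 1" "subspace U"
  shows "dim ((*v) S ` U) = dim U"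
proof (rule dim_image_eq)
  have "x = y" if "S *v x = S *v y" "x \<in> U" "y \<in> U" for x y
    using subspace_embedding_norm(1)[OF assms(1) subspace_diff[OF assms(3) that(2,3)]]
      assms(2) that(1)
    by (simp add: matrix_vector_mult_diff_distrib mult_le_0_iff)
  then show "inj_on ((*v) S) (span U)"
    unfolding span_eq_iff[THEN iffD2, OF assms(3)] by (intro inj_onI)
qed simp

text \<open>Independence says that the joint law and the product of the two laws agree on measurable
  rectangles, which determine the product measure.\<close>

lemma independent_distr:
  fixes X :: "'w \<Rightarrow> real^'a^'b" and Y :: "'w \<Rightarrow> real^'c^'d"
  assumes "prob_space M" and [measurable]: "X \<in> borel_measurable M" "Y \<in> borel_measurable M"
    and "independent_matrices M X Y"
  shows "distr M borel X \<Otimes>\<^sub>M distr M borel Y = distr M borel (\<lambda>\<omega>. (X \<omega>, Y \<omega>))"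
proof -
  interpret prob_space M by fact
  interpret X: prob_space "distr M borel X" by (rule prob_space_distr) simp
  interpret Y: prob_space "distr M borel Y" by (rule prob_space_distr) simp
  show ?thesis
  proof (rule pair_measure_eqI)
    show "sets (distr M borel X \<Otimes>\<^sub>M distr M borel Y) = sets (distr M borel (\<lambda>\<omega>. (X \<omega>, Y \<omega>)))"
      unfolding sets_distr borel_prod[symmetric] by (rule sets_pair_measure_cong) simp_all
    fix A B assume "A \<in> sets (distr M borel X)" "B \<in> sets (distr M borel Y)"
    then have AB: "A \<in> sets borel" "B \<in> sets borel" by simp_all
    then have AxB: "A \<times> B \<in> sets borel" by (simp flip: borel_prod)
    have "prob ((X -` A \<inter> space M) \<inter> (Y -` B \<inter> space M)) = prob (X -` A \<inter> space M) * prob (Y -` B \<inter> space M)"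
      using assms(4) AB unfolding independent_matrices_def by (intro indep_setD) auto
    moreover have "(\<lambda>\<omega>. (X \<omega>, Y \<omega>)) -` (A \<times> B) \<inter> space M = (X -` A \<inter> space M) \<inter> (Y -` B \<inter> space M)"
      by auto
    ultimately show "emeasure (distr M borel X) A * emeasure (distr M borel Y) B =
        emeasure (distr M borel (\<lambda>\<omega>. (X \<omega>, Y \<omega>))) (A \<times> B)"
      using AB AxB by (simp add: emeasure_distr emeasure_eq_measure ennreal_mult measure_nonneg)
  qed unfold_locales
qed

text \<open>The oblivious property speaks of fixed subspaces only. Freezing the first matrix
  \<open>A\<close> fixes the subspace to be embedded by the second, and integrating the resulting
  slice bounds against the law of the first gives the product.\<close>

lemma prob_composed_embedding:
  fixes S\<^sub>1 :: "'w \<Rightarrow> real^'n^'p1" and S\<^sub>2 :: "'w \<Rightarrow> real^'p1^'p2"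
  assumes "prob_space M"
    and S1: "oblivious_embedding M \<epsilon>\<^sub>1 d\<^sub>1 m S\<^sub>1" and S2: "oblivious_embedding M \<epsilon>\<^sub>2 d\<^sub>2 m S\<^sub>2"
    and "independent_matrices M S\<^sub>1 S\<^sub>2"
    and "\<epsilon>\<^sub>1 < 1" "d\<^sub>1 \<le> 1" "d\<^sub>2 \<le> 1" and U: "subspace U" "dim U = m"
  defines "E \<equiv> {\<omega> \<in> space M. subspace_embedding \<epsilon>\<^sub>1 (S\<^sub>1 \<omega>) U \<and>
                  subspace_embedding \<epsilon>\<^sub>2 (S\<^sub>2 \<omega>) ((*v) (S\<^sub>1 \<omega>) ` U)}"
  shows "E \<in> sets M" "(1 - d\<^sub>1) * (1 - d\<^sub>2) \<le> measure M E"
proof -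
  interpret prob_space M by fact
  have [measurable]: "S\<^sub>1 \<in> borel_measurable M" "S\<^sub>2 \<in> borel_measurable M"
    using S1 S2 by (auto simp: oblivious_embedding_def)
  let ?N1 = "distr M borel S\<^sub>1" and ?N2 = "distr M borel S\<^sub>2"
  interpret N1: prob_space ?N1 by (rule prob_space_distr) simp
  interpret N2: prob_space ?N2 by (rule prob_space_distr) simp
  define G1 where "G1 = {A :: real^'n^'p1. subspace_embedding \<epsilon>\<^sub>1 A U}"
  define G where "G = {(A :: real^'n^'p1, B :: real^'p1^'p2).
      subspace_embedding \<epsilon>\<^sub>1 A U \<and> subspace_embedding \<epsilon>\<^sub>2 B ((*v) A ` U)}"
  have G1: "G1 \<in> sets borel"
    by (simp add: G1_def closed_subspace_embedding_fixed)
  have "G = (G1 \<times> UNIV) \<inter> {p. subspace_embedding \<epsilon>\<^sub>2 (snd p) ((*v) (fst p) ` U)}"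
    by (auto simp: G_def G1_def)
  moreover have "closed {p :: (real^'n^'p1) \<times> (real^'p1^'p2).
      subspace_embedding \<epsilon>\<^sub>2 (snd p) ((*v) (fst p) ` U)}"
    by (intro closed_subspace_embedding continuous_intros)
  moreover have "closed (G1 \<times> (UNIV :: (real^'p1^'p2) set))"
    by (simp add: G1_def closed_subspace_embedding_fixed closed_Times)
  ultimately have G: "G \<in> sets borel" by (simp add: closed_Int)
  have E: "E = (\<lambda>\<omega>. (S\<^sub>1 \<omega>, S\<^sub>2 \<omega>)) -` G \<inter> space M"
    by (auto simp: E_def G_def)
  show "E \<in> sets M" unfolding E using G by measurable
  have slice: "ennreal (1 - d\<^sub>2) \<le> emeasure ?N2 (Pair A -` G)" if "A \<in> G1" for A
  proof -
    have "dim ((*v) A ` U) = m"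
      using that subspace_embedding_dim[of \<epsilon>\<^sub>1 A U] assms(5) U by (simp add: G1_def)
    then have "1 - d\<^sub>2 \<le> prob {\<omega> \<in> space M. subspace_embedding \<epsilon>\<^sub>2 (S\<^sub>2 \<omega>) ((*v) A ` U)}"
      using S2 U(1) by (auto simp: oblivious_embedding_def intro!: linear_subspace_image)
    also have "{\<omega> \<in> space M. subspace_embedding \<epsilon>\<^sub>2 (S\<^sub>2 \<omega>) ((*v) A ` U)} = S\<^sub>2 -` (Pair A -` G) \<inter> space M"
      using that by (auto simp: G_def G1_def)
    finally have "1 - d\<^sub>2 \<le> prob (S\<^sub>2 -` (Pair A -` G) \<inter> space M)" .
    moreover have "Pair A -` G \<in> sets borel"
      using G unfolding borel_prod[symmetric] by (rule sets_Pair1)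
    ultimately show ?thesis by (simp add: emeasure_distr emeasure_eq_measure ennreal_leI)
  qed
  have "1 - d\<^sub>1 \<le> prob {\<omega> \<in> space M. subspace_embedding \<epsilon>\<^sub>1 (S\<^sub>1 \<omega>) U}"
    using S1 U by (auto simp: oblivious_embedding_def)
  also have "{\<omega> \<in> space M. subspace_embedding \<epsilon>\<^sub>1 (S\<^sub>1 \<omega>) U} = S\<^sub>1 -` G1 \<inter> space M"
    by (auto simp: G1_def)
  finally have "ennreal (1 - d\<^sub>1) \<le> emeasure ?N1 G1"
    using G1 by (simp add: emeasure_distr emeasure_eq_measure ennreal_leI)
  then have "ennreal (1 - d\<^sub>2) * ennreal (1 - d\<^sub>1) \<le> ennreal (1 - d\<^sub>2) * emeasure ?N1 G1"
    by (rule mult_left_mono) simp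
  also have "\<dots> = (\<integral>\<^sup>+A. ennreal (1 - d\<^sub>2) * indicator G1 A \<partial>?N1)"
    using G1 by (simp add: nn_integral_cmult_indicator)
  \<comment> \<open>Off \<open>G1\<close> the left integrand vanishes; on \<open>G1\<close> it is
    the slice bound.\<close>
  also have "\<dots> \<le> (\<integral>\<^sup>+A. emeasure ?N2 (Pair A -` G) \<partial>?N1)"
    using slice by (intro nn_integral_mono) (simp add: indicator_def)
  also have "\<dots> = emeasure (?N1 \<Otimes>\<^sub>M ?N2) G"
  proof (rule N2.emeasure_pair_measure_alt[symmetric])
    show "G \<in> sets (?N1 \<Otimes>\<^sub>M ?N2)"
      using G unfolding borel_prod[symmetric]
      by (simp add: sets_pair_measure_cong[of ?N1 borel ?N2 borel])
  qed
  also have "\<dots> = emeasure M E"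
    unfolding E using G assms(1,4) by (simp add: independent_distr emeasure_distr)
  finally have "ennreal ((1 - d\<^sub>2) * (1 - d\<^sub>1)) \<le> ennreal (prob E)"
    using assms(6,7) by (simp add: ennreal_mult emeasure_eq_measure)
  then show "(1 - d\<^sub>1) * (1 - d\<^sub>2) \<le> prob E"
    by (simp add: ennreal_le_iff mult.commute)
qed

section \<open>Rounding errors in randQR\<close>

text \<open>Linearizes the error constant: once \<open>k * u\<close> is at most \<open>t\<close>,
  the denominator costs only a factor \<open>1 / (1 - t)\<close>.\<close>

lemma gam_bounds:
  assumes "0 \<le> u" "real k * u \<le> t" "t < 1"
  shows "0 \<le> gam u k" "gam u k \<le> real k * u / (1 - t)"
  using assms by (auto simp: gam_def intro!: divide_nonneg_nonneg divide_left_mono mult_pos_pos)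

text \<open>The total error is \<open>D2 + S\<^sub>2 ** D1\<close>. The entrywise bound on
  \<open>D2\<close> costs the Frobenius norm of \<open>S\<^sub>2\<close>, hence a factor
  \<open>sqrt p\<^sub>2\<close>, whereas the propagated error \<open>S\<^sub>2 ** D1\<close> costs
  only its spectral norm.\<close>

lemma sketch_error:
  fixes S\<^sub>1 :: "real^'n^'p1" and S\<^sub>2 :: "real^'p1^'p2" and V :: "real^'m^'n"
  assumes W1: "fl_matmul u S\<^sub>1 V W\<^sub>1" and W: "fl_matmul u S\<^sub>2 W\<^sub>1 W"
    and u: "0 \<le> u" "real CARD('n) * u \<le> 1/24"
      "real CARD('p1) * sqrt (real CARD('p2)) * u \<le> 1/12"
    and V: "norm V \<le> v" "norm (S\<^sub>1 ** V) \<le> b\<^sub>1 * v" "0 \<le> b\<^sub>1"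
  shows "norm (W - S\<^sub>2 ** (S\<^sub>1 ** V)) \<le> 6/5 * (spectral_norm S\<^sub>2 *
      (real CARD('p1) * sqrt (real CARD('p2)) * b\<^sub>1 + real CARD('n) * norm S\<^sub>1)) * u * v"
proof -
  define N1 where "N1 = norm S\<^sub>1"
  define N2 where "N2 = spectral_norm S\<^sub>2"
  define P where "P = real CARD('p1) * sqrt (real CARD('p2))"
  define gn where "gn = gam u CARD('n)"
  define gp where "gp = gam u CARD('p1)"
  define h where "h = gp * sqrt (real CARD('p2))"
  have N: "0 \<le> N1" "0 \<le> N2" "0 \<le> v"
    using order_trans[OF norm_ge_zero V(1)] by (simp_all add: N1_def N2_def onorm_pos_le)
  have "1 \<le> sqrt (real CARD('p2))" by (simp add: Suc_leI)
  then have "real CARD('p1) * u * 1 \<le> real CARD('p1) * u * sqrt (real CARD('p2))"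
    using u(1) by (intro mult_left_mono) simp_all
  then have "real CARD('p1) * u \<le> 1/12" using u(3) by (simp add: mult_ac)
  note gp = gam_bounds[OF u(1) this, folded gp_def]
  note gn = gam_bounds[OF u(1,2), folded gn_def]
  have gp0: "0 \<le> gp" and gn0: "0 \<le> gn" using gp gn by simp_all
  have "h \<le> real CARD('p1) * u / (1 - 1/12) * sqrt (real CARD('p2))"
    unfolding h_def using gp by (intro mult_right_mono) auto
  \<comment> \<open>The factors 12/11 and 24/23 are \<open>1 / (1 - t)\<close> for \<open>t\<close>
    equal to 1/12 and 1/24.\<close>
  then have h: "h \<le> 12/11 * (P * u)" by (simp add: P_def field_simps)
  then have h1: "h \<le> 1/11" using u(3) by (simp add: P_def)
  have h0: "0 \<le> h" using gp0 by (simp add: h_def)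
  have gn': "gn \<le> 24/23 * (real CARD('n) * u)" using gn(2) by simp
  define D1 where "D1 = W\<^sub>1 - S\<^sub>1 ** V"
  define D2 where "D2 = W - S\<^sub>2 ** W\<^sub>1"
  have D1: "norm D1 \<le> gn * (N1 * v)"
  proof -
    have "norm D1 \<le> gn * (N1 * norm V)"
      using fl_matmul_error[OF W1] gn0 by (simp add: gn_def N1_def D1_def)
    also have "\<dots> \<le> gn * (N1 * v)" using gn0 N V by (intro mult_left_mono) auto
    finally show ?thesis .
  qed
  have "norm W\<^sub>1 \<le> norm (S\<^sub>1 ** V) + norm D1"
    using norm_triangle_ineq[of "S\<^sub>1 ** V" D1] by (simp add: D1_def)
  then have W1n: "norm W\<^sub>1 \<le> b\<^sub>1 * v + gn * (N1 * v)" using D1 V by linarith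
  have "norm D2 \<le> gp * (norm S\<^sub>2 * norm W\<^sub>1)"
    using fl_matmul_error[OF W] gp0 by (simp add: gp_def D2_def)
  also have "\<dots> \<le> gp * ((sqrt (real CARD('p2)) * N2) * (b\<^sub>1 * v + gn * (N1 * v)))"
    using gp0 W1n N unfolding N2_def
    by (intro mult_left_mono mult_mono norm_matrix_le_spectral mult_nonneg_nonneg) auto
  also have "\<dots> = N2 * v * (h * b\<^sub>1 + h * gn * N1)"
    by (simp add: h_def algebra_simps)
  finally have D2: "norm D2 \<le> N2 * v * (h * b\<^sub>1 + h * gn * N1)" .
  have "norm (S\<^sub>2 ** D1) \<le> N2 * norm D1"
    unfolding N2_def by (intro norm_matrix_mult_le_gain onorm onorm_pos_le) auto
  also have "\<dots> \<le> N2 * (gn * (N1 * v))" using D1 N by (intro mult_left_mono) auto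
  finally have SD1: "norm (S\<^sub>2 ** D1) \<le> N2 * v * (gn * N1)" by (simp add: mult_ac)
  have "W - S\<^sub>2 ** (S\<^sub>1 ** V) = D2 + S\<^sub>2 ** D1"
    using matrix_add_ldistrib[of "S\<^sub>2" D1 "S\<^sub>1 ** V"] by (simp add: D1_def D2_def algebra_simps)
  then have "norm (W - S\<^sub>2 ** (S\<^sub>1 ** V)) \<le> norm D2 + norm (S\<^sub>2 ** D1)"
    using norm_triangle_ineq by metis
  also have "\<dots> \<le> N2 * v * (h * b\<^sub>1 + (1 + h) * (gn * N1))"
    using D2 SD1 by (simp add: algebra_simps)
  \<comment> \<open>The second-order term is absorbed by \<open>1 + h \<le> 12/11\<close>;
    afterwards 12/11 times 24/23 is below 6/5.\<close>
  also have "\<dots> \<le> N2 * v * (6/5 * (P * u) * b\<^sub>1 + 12/11 * ((24/23 * (real CARD('n) * u)) * N1))"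
    using h h1 h0 gn' gn0 N V(3) u
    by (intro mult_left_mono add_mono mult_mono mult_nonneg_nonneg) (auto simp: P_def)
  also have "\<dots> \<le> N2 * v * (6/5 * (P * u) * b\<^sub>1 + 6/5 * (real CARD('n) * u * N1))"
    using N u(1) by (intro mult_left_mono add_mono) (auto simp: P_def)
  also have "\<dots> = 6/5 * (N2 * (P * b\<^sub>1 + real CARD('n) * N1)) * u * v"
    by (simp add: algebra_simps)
  finally show ?thesis by (simp add: N1_def N2_def P_def)
qed

text \<open>The deterministic part. Here \<open>a\<close>, \<open>b\<close>,
  \<open>b\<^sub>1\<close> are gains of the sketches on the range of \<open>V\<close>,
  \<open>s\<close> and \<open>\<sigma>\<close> are gain bounds for \<open>V\<close>, and
  \<open>small\<close> is the condition \<open>\<delta> \<le> 1\<close> with denominators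
  cleared.\<close>

lemma randQR_gains:
  fixes V :: "real^('m::{finite,linorder})^'n" and S\<^sub>1 :: "real^'n^'p1" and S\<^sub>2 :: "real^'p1^'p2"
  assumes fl: "fl_randQR u V S\<^sub>1 S\<^sub>2 Q R"
    and dims: "1 < CARD('m)" "CARD('m) \<le> CARD('p2)"
    and u: "0 < u" "real CARD('n) * real CARD('m) * u \<le> 1/12"
      "real CARD('p1) * sqrt (real CARD('p2)) * u \<le> 1/12"
    and ab: "0 < a" "a \<le> b" "0 \<le> b\<^sub>1"
    and V: "0 < s" "\<And>x. s * norm x \<le> norm (V *v x)" "\<And>x. norm (V *v x) \<le> \<sigma> * norm x"
    and S1V: "\<And>x. norm (S\<^sub>1 *v (V *v x)) \<le> b\<^sub>1 * norm (V *v x)"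
    and SV: "\<And>x. a * norm (V *v x) \<le> norm (S\<^sub>2 *v (S\<^sub>1 *v (V *v x)))"
      "\<And>x. norm (S\<^sub>2 *v (S\<^sub>1 *v (V *v x))) \<le> b * norm (V *v x)"
    and small: "383 * (b * real CARD('p2) * (real CARD('m) * sqrt (real CARD('m)))
        + sqrt (real CARD('m)) * spectral_norm S\<^sub>2 *
          (real CARD('p1) * sqrt (real CARD('p2)) * b\<^sub>1 + real CARD('n) * norm S\<^sub>1)) * u * \<sigma> \<le> a * s"
  shows "249/250 / (b + a/10) * norm y \<le> norm (Q *v y)" "norm (Q *v y) \<le> 28/25 / a * norm y"
proof -
  define m where "m = real CARD('m)"
  \<comment> \<open>These are the two summands of \<open>small\<close> without the factor 383: the
    first governs the sketching error, the second the Householder error.\<close>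
  define p where "p = real CARD('p2)"
  define \<tau>\<^sub>1 where "\<tau>\<^sub>1 = sqrt m * spectral_norm S\<^sub>2 *
      (real CARD('p1) * sqrt p * b\<^sub>1 + real CARD('n) * norm S\<^sub>1) * u * \<sigma>"
  define \<tau>\<^sub>2 where "\<tau>\<^sub>2 = p * m * u * (sqrt m * b * \<sigma>)"
  obtain W\<^sub>1 W where W1: "fl_matmul u S\<^sub>1 V W\<^sub>1" and W: "fl_matmul u S\<^sub>2 W\<^sub>1 W"
    and R: "fl_householder_R u W R" and Q: "fl_row_solve u R V Q"
    using fl by (auto simp: fl_randQR_def)
  define W\<^sub>0 where "W\<^sub>0 = S\<^sub>2 ** (S\<^sub>1 ** V)"
  have W0x: "W\<^sub>0 *v x = S\<^sub>2 *v (S\<^sub>1 *v (V *v x))" for x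
    by (simp add: W\<^sub>0_def flip: matrix_vector_mul_assoc)
  have m: "2 \<le> m" "m \<le> p" "1 \<le> sqrt m" using dims by (auto simp: m_def p_def)
  have "s \<le> \<sigma>"
    using order_trans[OF V(2)[of "axis undefined 1"] V(3)[of "axis undefined 1"]] by simp
  have pos: "0 < b" "0 < \<sigma>" "0 < a * s" using ab V(1) \<open>s \<le> \<sigma>\<close> by auto
  have nonneg: "0 \<le> \<tau>\<^sub>1" "0 \<le> \<tau>\<^sub>2"
    using m pos u(1) ab(3) by (auto simp: \<tau>\<^sub>1_def \<tau>\<^sub>2_def p_def onorm_pos_le
        intro!: mult_nonneg_nonneg add_nonneg_nonneg)
  have \<tau>: "383 * (\<tau>\<^sub>1 + \<tau>\<^sub>2) \<le> a * s"
    using small by (simp add: \<tau>\<^sub>1_def \<tau>\<^sub>2_def m_def p_def algebra_simps)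
  have as_le: "a * s \<le> sqrt m * b * \<sigma>"
  proof -
    have "1 * (a * s) \<le> sqrt m * (b * \<sigma>)"
      using m ab V(1) pos \<open>s \<le> \<sigma>\<close> by (intro mult_mono) auto
    then show ?thesis by (simp add: mult.assoc)
  qed
  \<comment> \<open>Since \<open>sqrt m * b * \<sigma>\<close> is at least \<open>a * s\<close>, the
    condition number can be cancelled from the Householder part of \<open>small\<close>, leaving a
    bound on \<open>p * m * u\<close> alone.\<close>
  have "383 * (p * m * u) * (a * s) \<le> 383 * \<tau>\<^sub>2"
    unfolding \<tau>\<^sub>2_def using as_le m u(1) by (simp add: mult.assoc)
  also have "\<dots> \<le> 1 * (a * s)" using \<tau> nonneg by simp
  finally have "383 * (p * m * u) \<le> 1" using pos(3) by (rule mult_right_le_imp_le)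
  then have pmu: "p * m * u \<le> 1/383" by simp

  have Vnorm: "norm V \<le> sqrt m * \<sigma>"
    unfolding m_def by (rule norm_matrix_le_gain) (rule V)
  have S1Vnorm: "norm (S\<^sub>1 ** V) \<le> b\<^sub>1 * (sqrt m * \<sigma>)"
  proof -
    have "norm (S\<^sub>1 ** V) \<le> sqrt m * (b\<^sub>1 * \<sigma>)"
      unfolding m_def
    proof (rule norm_matrix_le_gain)
      fix x show "norm ((S\<^sub>1 ** V) *v x) \<le> b\<^sub>1 * \<sigma> * norm x"
        using order_trans[OF S1V mult_left_mono[OF V(3) ab(3)]]
        by (simp add: mult.assoc flip: matrix_vector_mul_assoc)
    qed
    then show ?thesis by (simp add: mult_ac)
  qed
  have W0norm: "norm W\<^sub>0 \<le> sqrt m * b * \<sigma>"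
  proof -
    have "norm W\<^sub>0 \<le> sqrt m * (b * \<sigma>)"
      unfolding m_def
    proof (rule norm_matrix_le_gain)
      fix x show "norm (W\<^sub>0 *v x) \<le> b * \<sigma> * norm x"
        using order_trans[OF SV(2) mult_left_mono[OF V(3)]] pos by (simp add: W0x mult.assoc)
    qed
    then show ?thesis by (simp add: mult_ac)
  qed
  \<comment> \<open>Here \<open>m \<ge> 2\<close> enters: it halves the bound 1/12 to the 1/24
    required by \<open>sketch_error\<close>.\<close>
  have "real CARD('n) * u * 2 \<le> real CARD('n) * u * m"
    using m u(1) by (intro mult_left_mono) auto
  then have "real CARD('n) * u \<le> 1/24" using u(2) by (simp add: m_def mult_ac)
  from sketch_error[OF W1 W _ this u(3) Vnorm S1Vnorm ab(3)] u(1)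
  have E1: "norm (W - W\<^sub>0) \<le> 6/5 * \<tau>\<^sub>1"
    by (simp add: \<tau>\<^sub>1_def W\<^sub>0_def p_def mult_ac)

  define g where "g = gam u (29 * CARD('p2) * CARD('m))"
  have k: "real (29 * CARD('p2) * CARD('m)) * u = 29 * (p * m * u)" by (simp add: p_def m_def)
  have "real (29 * CARD('p2) * CARD('m)) * u \<le> 29/383" unfolding k using pmu by linarith
  from gam_bounds[OF less_imp_le[OF u(1)] this, folded g_def, unfolded k]
  have g: "0 \<le> g" "g \<le> 29 * (p * m * u) / (1 - 29/383)" by simp_all
  obtain E where E: "norm E \<le> g * norm W" and Rx: "\<And>x. norm (R *v x) = norm ((W + E) *v x)"
    using fl_householder_R_backward_error[OF R] g(1) unfolding g_def by metis
  have \<tau>1: "383 * \<tau>\<^sub>1 \<le> sqrt m * b * \<sigma>" using \<tau> nonneg as_le by simp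
  have "norm W \<le> norm W\<^sub>0 + norm (W - W\<^sub>0)"
    using norm_triangle_ineq[of W\<^sub>0 "W - W\<^sub>0"] by simp
  \<comment> \<open>The relative excess is at most 6/5 divided by 383, which is below 1/250.\<close>
  also have "\<dots> \<le> 251/250 * (sqrt m * b * \<sigma>)"
    using add_mono[OF W0norm E1] \<tau>1 nonneg(1) by (simp add: field_simps)
  finally have "g * norm W \<le> 29 * (p * m * u) / (1 - 29/383) * (251/250 * (sqrt m * b * \<sigma>))"
    using g m u(1) by (intro mult_mono) auto
  also have "\<dots> \<le> 32 * \<tau>\<^sub>2" using nonneg(2) by (simp add: \<tau>\<^sub>2_def mult_ac)
  finally have "norm E \<le> 32 * \<tau>\<^sub>2" using E by simp
  \<comment> \<open>The sum \<open>6/5 * \<tau>\<^sub>1 + 32 * \<tau>\<^sub>2\<close> is at most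
    32/383 of \<open>a * s\<close>, which is below one tenth.\<close>
  then have "norm (W - W\<^sub>0 + E) \<le> a * s / 10"
    using norm_triangle_ineq[of "W - W\<^sub>0" E] E1 \<tau> nonneg pos(3) by simp
  \<comment> \<open>The least gain \<open>s\<close> of \<open>V\<close> turns the absolute error
    into one relative to \<open>norm (V *v x)\<close>.\<close>
  then have Ex: "norm ((W - W\<^sub>0 + E) *v x) \<le> a / 10 * norm (V *v x)" for x
  proof -
    have "norm ((W - W\<^sub>0 + E) *v x) \<le> a * s / 10 * norm x"
      using \<open>norm (W - W\<^sub>0 + E) \<le> a * s / 10\<close>
      by (meson norm_matrix_vector_mult_le mult_right_mono norm_ge_zero order_trans)
    also have "\<dots> \<le> a / 10 * norm (V *v x)"
      using mult_left_mono[OF V(2)[of x], of "a / 10"] ab(1) by simp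
    finally show ?thesis .
  qed
  have decomp: "(W + E) *v x = W\<^sub>0 *v x + (W - W\<^sub>0 + E) *v x" for x
    by (simp flip: matrix_vector_mult_add_rdistrib)
  have R_lower: "9/10 * a * norm (V *v x) \<le> norm (R *v x)" for x
    using norm_diff_ineq[of "W\<^sub>0 *v x" "(W - W\<^sub>0 + E) *v x"] SV(1)[of x] Ex[of x]
    unfolding Rx decomp W0x by simp
  have R_upper: "norm (R *v x) \<le> (b + a/10) * norm (V *v x)" for x
    using norm_triangle_ineq[of "W\<^sub>0 *v x" "(W - W\<^sub>0 + E) *v x"] SV(2)[of x] Ex[of x]
    unfolding Rx decomp W0x by (simp add: algebra_simps)

  have injR: "inj ((*v) R)"
    unfolding linear_injective_0[OF matrix_vector_mul_linear]
  proof (intro allI impI)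
    fix x assume "R *v x = 0"
    then have "a * norm (V *v x) \<le> 0" using R_lower[of x] by simp
    then have "s * norm x \<le> 0" using V(2)[of x] ab(1) by (simp add: mult_le_0_iff)
    then show "x = 0" using V(1) by (simp add: mult_le_0_iff)
  qed
  then have surjR: "surj ((*v) R)"
    by (simp add: linear_injective_imp_surjective)
  have diag: "R $ j $ j \<noteq> 0" for j
    using upper_triangular_inj_diag[OF _ injR] R by (simp add: fl_householder_R_def)

  define q where "q = spectral_norm Q"
  have q: "0 \<le> q" "\<And>y. norm (Q *v y) \<le> q * norm y"
    by (simp_all add: q_def onorm_pos_le onorm)
  \<comment> \<open>The residual bound contains the unknown spectral norm \<open>q\<close> of
    \<open>Q\<close>, which is eliminated only after \<open>Q_upper\<close>.\<close>
  define F where "F = Q ** R - V"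
  have mmu: "m * m * u \<le> p * m * u" using m u(1) by (simp add: mult_right_mono)
  have "1 * m \<le> m * m" using m by (intro mult_right_mono) auto
  then have mu: "m * u \<le> 1/383"
    using mult_right_mono[of "1 * m" "m * m" u] mmu pmu u(1) by simp
  have gm: "0 \<le> gam u CARD('m)" "gam u CARD('m) \<le> 383/382 * (m * u)"
    using gam_bounds[of u "CARD('m)" "1/383"] u(1) mu by (simp_all add: m_def)
  have Rnorm: "norm R \<le> sqrt m * (11/10 * b * \<sigma>)"
    unfolding m_def
  proof (rule norm_matrix_le_gain)
    fix x
    have "norm (R *v x) \<le> 11/10 * b * norm (V *v x)"
      using ab by (intro order_trans[OF R_upper] mult_right_mono) auto
    also have "\<dots> \<le> 11/10 * b * (\<sigma> * norm x)"
      using pos by (intro mult_left_mono V) auto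
    finally show "norm (R *v x) \<le> 11/10 * b * \<sigma> * norm x" by (simp add: mult.assoc)
  qed
  have Qnorm: "norm Q \<le> sqrt m * q" unfolding m_def by (rule norm_matrix_le_gain) (rule q)
  have "norm F \<le> gam u CARD('m) * (norm Q * norm R)"
    unfolding F_def by (rule fl_row_solve_residual[OF Q diag gm(1)])
  also have "\<dots> \<le> 383/382 * (m * u) * ((sqrt m * q) * (sqrt m * (11/10 * b * \<sigma>)))"
    using gm Qnorm Rnorm q(1) m u(1) by (intro mult_mono mult_nonneg_nonneg) auto
  also have "\<dots> = 383/382 * 11/10 * q * (m * m * u * b * \<sigma>)"
    using m by (simp add: algebra_simps flip: real_sqrt_mult)
  also have "\<dots> \<le> 383/382 * 11/10 * q * (a * s / 383)"
  proof (intro mult_left_mono)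
    have "m * m * u * b * \<sigma> \<le> p * m * u * b * \<sigma>"
      using m u(1) pos by (intro mult_right_mono) auto
    also have "\<dots> \<le> sqrt m * (p * m * u * b * \<sigma>)"
      using mult_right_mono[OF m(3), of "p * m * u * b * \<sigma>"] m pos u(1) by simp
    also have "\<dots> = \<tau>\<^sub>2" by (simp add: \<tau>\<^sub>2_def mult_ac)
    finally show "m * m * u * b * \<sigma> \<le> a * s / 383" using \<tau> nonneg by simp
  qed (use q in simp)
  \<comment> \<open>The factor 383/382 comes from \<open>gm\<close>, and 11/10 from
    \<open>b + a/10 \<le> 11/10 * b\<close>; their product divided by 383 is below 1/300.\<close>
  also have "\<dots> \<le> q * a * s / 300" using q(1) ab(1) V(1) by simp
  finally have Fnorm: "norm F \<le> q * a / 300 * s" by simp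
  have Fx: "norm (F *v x) \<le> q * a / 300 * norm (V *v x)" for x
  proof -
    have "norm (F *v x) \<le> q * a / 300 * s * norm x"
      using Fnorm by (meson norm_matrix_vector_mult_le mult_right_mono norm_ge_zero order_trans)
    also have "\<dots> \<le> q * a / 300 * norm (V *v x)"
      using mult_left_mono[OF V(2)[of x], of "q * a / 300"] q(1) ab(1) by (simp add: mult.assoc)
    finally show ?thesis .
  qed
  have QR: "Q *v (R *v x) = V *v x + F *v x" for x
    by (simp add: F_def matrix_vector_mul_assoc flip: matrix_vector_mult_add_rdistrib)
  have Q_upper: "norm (Q *v y) \<le> (1 + q * a / 300) / (9/10 * a) * norm y" for y
  proof -
    obtain x where y: "y = R *v x" using surjR by (metis surjD)
    have "norm (Q *v y) \<le> (1 + q * a / 300) * norm (V *v x)"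
      using norm_triangle_ineq[of "V *v x" "F *v x"] Fx[of x] by (simp add: y QR algebra_simps)
    also have "\<dots> \<le> (1 + q * a / 300) * (norm y / (9/10 * a))"
    proof (rule mult_left_mono)
      show "norm (V *v x) \<le> norm y / (9/10 * a)"
        using R_lower[of x] ab(1) by (simp add: y field_simps)
    qed (use q(1) ab(1) in simp)
    finally show ?thesis by (simp only: times_divide_eq_left times_divide_eq_right)
  qed
  \<comment> \<open>Applying \<open>Q_upper\<close> to the operator norm bounds \<open>q\<close> in
    terms of itself. Solving gives \<open>q * a \<le> 300/269\<close>, which is below 28/25.\<close>
  have "q \<le> (1 + q * a / 300) / (9/10 * a)"
    unfolding q_def by (rule onorm_le) (rule Q_upper[unfolded q_def])
  then have qa: "q * a \<le> 28/25" using ab(1) by (simp add: field_simps)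
  then have "q \<le> 28/25 / a" using ab(1) by (simp add: field_simps)
  then show "norm (Q *v y) \<le> 28/25 / a * norm y"
    by (meson q(2) mult_right_mono norm_ge_zero order_trans)
  obtain x where y: "y = R *v x" using surjR by (metis surjD)
  \<comment> \<open>With \<open>q\<close> bounded, the relative residual is at most 28/25 divided by
    300, below 1/250; this leaves the factor 249/250 in the lower gain.\<close>
  have "norm (F *v x) \<le> 1/250 * norm (V *v x)"
    using qa by (intro order_trans[OF Fx] mult_right_mono) (simp_all add: mult_ac)
  then have "249/250 * norm (V *v x) \<le> norm (Q *v y)"
    using norm_diff_ineq[of "V *v x" "F *v x"] by (simp add: y QR)
  moreover have "norm y / (b + a/10) \<le> norm (V *v x)"
    using R_upper[of x] ab pos by (simp add: y field_simps)
  ultimately have "249/250 * (norm y / (b + a/10)) \<le> norm (Q *v y)" by linarith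
  then show "249/250 / (b + a/10) * norm y \<le> norm (Q *v y)"
    by (simp only: times_divide_eq_left times_divide_eq_right)
qed

section \<open>The condition number bound and its probability\<close>

lemma gain_ratio_le:
  fixes a b :: real
  assumes "0 < a" "a \<le> b" "3/25 < a / b"
  shows "28/25 / a / (249/250 / (b + a/10)) \<le> 33 / (25 * (a / b) - 3)"
proof -
  define r where "r = a / b"
  have b: "0 < b" and r: "3/25 < r" "r \<le> 1" using assms by (auto simp: r_def)
  have "28/25 / a / (249/250 / (b + a/10)) = 280/249 * (1 + r/10) / r"
    using assms(1) b by (simp add: r_def field_simps)
  also have "\<dots> \<le> 33/25 / (r - 3/25)"
  proof -
    \<comment> \<open>As \<open>r \<le> 1\<close>, the first factor is at most 308/249, below 33/25;
      enlarging \<open>r - 3/25\<close> to \<open>r\<close> afterwards allows cross-multiplication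
      to the stated form.\<close>
    have "280/249 * (1 + r/10) * (r - 3/25) \<le> 33/25 * (r - 3/25)"
      using r by (intro mult_right_mono) auto
    also have "\<dots> \<le> 33/25 * r" by simp
    finally show ?thesis using r by (simp add: field_simps)
  qed
  also have "\<dots> = 33 / (25 * r - 3)" using r by (simp add: field_simps)
  finally show ?thesis by (simp add: r_def)
qed

theorem theorem5p2:
  fixes M :: "'w measure"
    and S\<^sub>1 :: "'w \<Rightarrow> real^'n^'p1"
    and S\<^sub>2 :: "'w \<Rightarrow> real^'p1^'p2"
    and V :: "real^('m::{finite,linorder})^'n"
    and Qhat :: "'w \<Rightarrow> real^('m::{finite,linorder})^'n"
    and Rhat :: "'w \<Rightarrow> real^('m::{finite,linorder})^('m::{finite,linorder})"
    and \<epsilon>\<^sub>1 \<epsilon>\<^sub>2 \<epsilon>\<^sub>L \<epsilon>\<^sub>H d\<^sub>1 d\<^sub>2 d u :: real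
    and n m p\<^sub>1 p\<^sub>2 :: nat
    and \<delta> :: "'w \<Rightarrow> ereal"
  assumes "prob_space M"
    and dims: "n = CARD('n)" "m = CARD('m)" "p\<^sub>1 = CARD('p1)" "p\<^sub>2 = CARD('p2)"
    and "1 < m" "m \<le> p\<^sub>2" "p\<^sub>2 \<le> p\<^sub>1" "p\<^sub>1 \<le> n"
    and "\<epsilon>\<^sub>1 \<in> {0..<1}" "\<epsilon>\<^sub>2 \<in> {0..<1}" "d\<^sub>1 \<in> {0..1}" "d\<^sub>2 \<in> {0..1}"
    and "oblivious_embedding M \<epsilon>\<^sub>1 d\<^sub>1 m S\<^sub>1"
    and "oblivious_embedding M \<epsilon>\<^sub>2 d\<^sub>2 m S\<^sub>2"
    and "independent_matrices M S\<^sub>1 S\<^sub>2"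
    and "d = d\<^sub>1 + d\<^sub>2 - d\<^sub>1 * d\<^sub>2"
    and "\<epsilon>\<^sub>L = \<epsilon>\<^sub>1 + \<epsilon>\<^sub>2 - \<epsilon>\<^sub>1 * \<epsilon>\<^sub>2"
    and "\<epsilon>\<^sub>H = \<epsilon>\<^sub>1 + \<epsilon>\<^sub>2 + \<epsilon>\<^sub>1 * \<epsilon>\<^sub>2"
    and "\<epsilon>\<^sub>L \<in> {0..<616/625 - 9/625 * \<epsilon>\<^sub>H}"
    and "rank V = m"
    and "0 < u"
    and "real n * real m * u \<le> 1/12"
    and "real p\<^sub>1 * sqrt (real p\<^sub>2) * u \<le> 1/12"
    and "\<And>\<omega>. \<omega> \<in> space M \<Longrightarrow>
      \<delta> \<omega> = ereal (383 * (sqrt (1 + \<epsilon>\<^sub>H) * real p\<^sub>2 * real m powr (3/2)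
                     + sqrt (real m) * spectral_norm (S\<^sub>2 \<omega>)
                       * (real p\<^sub>1 * sqrt (real p\<^sub>2) * sqrt (1 + \<epsilon>\<^sub>1)
                          + real n * frobenius_norm (S\<^sub>1 \<omega>)))
                   / sqrt (1 - \<epsilon>\<^sub>L) * u) * cond_number V"
    and "\<And>\<omega>. \<omega> \<in> space M \<Longrightarrow> fl_randQR u V (S\<^sub>1 \<omega>) (S\<^sub>2 \<omega>) (Qhat \<omega>) (Rhat \<omega>)"
  shows "\<exists>E \<in> sets M. measure M E \<ge> 1 - d \<and>
           (\<forall>\<omega>\<in>E. \<delta> \<omega> \<le> 1 \<longrightarrow>
              cond_number (Qhat \<omega>) \<le> ereal (33 / (25 * sqrt ((1 - \<epsilon>\<^sub>L) / (1 + \<epsilon>\<^sub>H)) - 3)))"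
proof -
  define U where "U = range ((*v) V)"
  have V: "rank V = CARD('m)" using assms(21) dims(2) by simp
  have U: "subspace U" "dim U = m"
    using assms(21) by (auto simp: U_def rank_dim_range intro!: linear_subspace_image)
  define E where "E = {\<omega> \<in> space M. subspace_embedding \<epsilon>\<^sub>1 (S\<^sub>1 \<omega>) U \<and>
      subspace_embedding \<epsilon>\<^sub>2 (S\<^sub>2 \<omega>) ((*v) (S\<^sub>1 \<omega>) ` U)}"
  have \<epsilon>: "0 \<le> \<epsilon>\<^sub>1" "\<epsilon>\<^sub>1 < 1" "0 \<le> \<epsilon>\<^sub>2" "\<epsilon>\<^sub>2 < 1" using assms(10,11) by auto
  have E: "E \<in> sets M" "(1 - d\<^sub>1) * (1 - d\<^sub>2) \<le> measure M E"
    unfolding E_def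
    using prob_composed_embedding[OF assms(1,14,15,16) \<epsilon>(2) _ _ U] assms(12,13) by auto
  define a where "a = sqrt (1 - \<epsilon>\<^sub>L)"
  define b where "b = sqrt (1 + \<epsilon>\<^sub>H)"
  define s where "s = sigma_min V"
  define \<sigma> where "\<sigma> = sigma_max V"
  \<comment> \<open>The definitions of \<open>\<epsilon>\<^sub>L\<close> and
    \<open>\<epsilon>\<^sub>H\<close> factor as \<open>1 - \<epsilon>\<^sub>L = (1 -
    \<epsilon>\<^sub>1) * (1 - \<epsilon>\<^sub>2)\<close> and \<open>1 + \<epsilon>\<^sub>H = (1 +
    \<epsilon>\<^sub>1) * (1 + \<epsilon>\<^sub>2)\<close>, so the gains of the two sketches
    multiply to \<open>a\<close> and \<open>b\<close>.\<close>
  have a_eq: "a = sqrt (1 - \<epsilon>\<^sub>1) * sqrt (1 - \<epsilon>\<^sub>2)"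
    by (simp add: a_def assms(18) algebra_simps flip: real_sqrt_mult)
  have b_eq: "b = sqrt (1 + \<epsilon>\<^sub>1) * sqrt (1 + \<epsilon>\<^sub>2)"
    by (simp add: b_def assms(19) algebra_simps flip: real_sqrt_mult)
  have ab: "0 < a" "a \<le> b"
    using \<epsilon> unfolding a_eq b_eq by (auto intro!: mult_mono)
  have r: "3/25 < a / b"
  proof -
    \<comment> \<open>The range assumed for \<open>\<epsilon>\<^sub>L\<close>, rearranged; its
      square root is exactly the positivity of the denominator in the final bound.\<close>
    have "9/625 * (1 + \<epsilon>\<^sub>H) < 1 - \<epsilon>\<^sub>L" using assms(20) by (simp add: field_simps)
    then have "sqrt (9/625 * (1 + \<epsilon>\<^sub>H)) < a" unfolding a_def by (rule real_sqrt_less_mono)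
    moreover have "sqrt (9/625) = (3/25 :: real)" by (rule real_sqrt_unique) (auto simp: power2_eq_square)
    ultimately have "3/25 * b < a" unfolding b_def real_sqrt_mult by simp
    then show ?thesis using ab by (simp add: field_simps)
  qed
  have s: "0 < s" using full_rank_sigma_min_pos[OF V] by (simp add: s_def)
  have "cond_number (Qhat \<omega>) \<le> ereal (33 / (25 * sqrt ((1 - \<epsilon>\<^sub>L) / (1 + \<epsilon>\<^sub>H)) - 3))"
    if "\<omega> \<in> E" "\<delta> \<omega> \<le> 1" for \<omega>
  proof -
    have \<omega>: "\<omega> \<in> space M" and e1: "subspace_embedding \<epsilon>\<^sub>1 (S\<^sub>1 \<omega>) U"
      and e2: "subspace_embedding \<epsilon>\<^sub>2 (S\<^sub>2 \<omega>) ((*v) (S\<^sub>1 \<omega>) ` U)"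
      using that(1) by (auto simp: E_def)
    have g1: "sqrt (1 - \<epsilon>\<^sub>1) * norm (V *v x) \<le> norm (S\<^sub>1 \<omega> *v (V *v x))"
      "norm (S\<^sub>1 \<omega> *v (V *v x)) \<le> sqrt (1 + \<epsilon>\<^sub>1) * norm (V *v x)" for x
      using subspace_embedding_norm[OF e1] by (auto simp: U_def)
    have g2: "sqrt (1 - \<epsilon>\<^sub>2) * norm (S\<^sub>1 \<omega> *v (V *v x)) \<le> norm (S\<^sub>2 \<omega> *v (S\<^sub>1 \<omega> *v (V *v x)))"
      "norm (S\<^sub>2 \<omega> *v (S\<^sub>1 \<omega> *v (V *v x))) \<le> sqrt (1 + \<epsilon>\<^sub>2) * norm (S\<^sub>1 \<omega> *v (V *v x))" for x
      using subspace_embedding_norm[OF e2] by (auto simp: U_def)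
    have lower: "a * norm (V *v x) \<le> norm (S\<^sub>2 \<omega> *v (S\<^sub>1 \<omega> *v (V *v x)))" for x
      using order_trans[OF mult_left_mono[where c = "sqrt (1 - \<epsilon>\<^sub>2)", OF g1(1)] g2(1)] \<epsilon>
      by (simp add: a_eq mult_ac)
    have upper: "norm (S\<^sub>2 \<omega> *v (S\<^sub>1 \<omega> *v (V *v x))) \<le> b * norm (V *v x)" for x
      using order_trans[OF g2(2) mult_left_mono[OF g1(2)]] \<epsilon> by (simp add: b_eq mult_ac)
    let ?c = "383 * (b * real CARD('p2) * (real CARD('m) * sqrt (real CARD('m)))
        + sqrt (real CARD('m)) * spectral_norm (S\<^sub>2 \<omega>) *
          (real CARD('p1) * sqrt (real CARD('p2)) * sqrt (1 + \<epsilon>\<^sub>1) + real CARD('n) * norm (S\<^sub>1 \<omega>)))"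
    have "real m powr (3/2) = real m powr 1 * real m powr (1/2)"
      unfolding powr_add[symmetric] by simp
    then have "real m powr (3/2) = real m * sqrt (real m)"
      using assms(6) by (simp add: powr_half_sqrt)
    then have "\<delta> \<omega> = ereal (?c / a * u) * cond_number V"
      using assms(25)[OF \<omega>] by (simp add: dims a_def b_def)
    \<comment> \<open>Full rank makes \<open>s\<close> positive, so the condition number of
      \<open>V\<close> is the finite ratio \<open>\<sigma> / s\<close> and the extended-real
      inequality becomes a real one.\<close>
    then have "?c / a * u * (\<sigma> / s) \<le> 1"
      using that(2) s by (simp add: cond_number_def s_def \<sigma>_def)
    then have small: "?c * u * \<sigma> \<le> a * s"
      using ab s by (simp add: field_simps)
    note gains = randQR_gains[OF assms(26)[OF \<omega>] _ _ assms(22) _ _ ab _ s _ _ g1(2) lower upper small]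
    have gains: "249/250 / (b + a/10) * norm y \<le> norm (Qhat \<omega> *v y)"
      "norm (Qhat \<omega> *v y) \<le> 28/25 / a * norm y" for y
      using gains[of y] assms(6,7,23,24) \<epsilon> sigma_min_gain[of V] sigma_max_gain[of V]
      by (simp_all add: dims s_def \<sigma>_def)
    have "cond_number (Qhat \<omega>) \<le> ereal (28/25 / a / (249/250 / (b + a/10)))"
      using ab by (intro cond_number_le gains) simp
    also have "\<dots> \<le> ereal (33 / (25 * (a / b) - 3))"
      using gain_ratio_le[OF ab r] by simp
    finally show ?thesis by (simp add: a_def b_def real_sqrt_divide)
  qed
  moreover have "1 - d \<le> measure M E" using E(2) by (simp add: assms(17) algebra_simps)
  ultimately show ?thesis using E(1) by blast
qed

end
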